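(* Let $k\geq 3$. The function $v\mapsto v_{\mathrm{red}}$, from the forward positive cone in $\mathbb{R}^{1+k}$ to the intersection of the forward positive cone with the cone of reduced vectors, is continuous.
   Context: Let $k\ge3$ and write vectors of $\mathbb{R}^{1+k}$ as $(\lambda;\delta_1,\ldots,\delta_k)$. The forward positive cone is $\{(\lambda;\delta_1,\ldots,\delta_k) : \lambda^2-\delta_1^2-\cdots-\delta_k^2>0 \text{ and } \lambda>0\}$. A vector is reduced if $\delta_1\geq\cdots\geq\delta_k$ and $\delta_1+\delta_2+\delta_3\leq\lambda$. For $v=(\lambda;\delta_1,\ldots,\delta_k)$ set $\mathrm{defect}(v)=\delta_1+\delta_2+\delta_3-\lambda$ and let $\mathrm{cremona}(v)=(\lambda';\delta'_1,\ldots,\delta'_k)$ with $\lambda'=\lambda-\mathrm{defect}(v)$, $\delta'_j=\delta_j-\mathrm{defect}(v)$ for $1\le j\le 3$, and $\delta'_j=\delta_j$ for $4\le j\le k$. The standard Cremona move on $\mathbb{R}^{1+k}$ is the composition of two maps: first permute the last $k$ entries of the vector so that they are in weakly decreasing order; then, to the resulting vector $w$, apply $w\mapsto\mathrm{cremona}(w)$ if $\mathrm{defect}(w)\geq0$ and $w\mapsto w$ otherwise. The vectors fixed by the standard Cremona move are exactly the reduced vectors. For $v$ in the forward positive cone, iterating the standard Cremona move on $v$ yields, after finitely many steps, a reduced vector (in the forward positive cone); $v_{\mathrm{red}}$ denotes this reduced vector (with $v_{\mathrm{red}}=v$ if $v$ is reduced). *)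

theory Defs
  imports "HOL-Analysis.Analysis"
begin

text \<open>
  The space \<open>\<real>\<^sup>1\<^sup>+\<^sup>k\<close> is the library space \<open>Euclidean_space (Suc k)\<close>: its points are the functions
  \<open>v :: nat \<Rightarrow> real\<close> vanishing at all indices greater than \<open>k\<close>, with the topology induced from the
  product topology. The vector \<open>(\<lambda>; \<delta>\<^sub>1, \<dots>, \<delta>\<^sub>k)\<close> is encoded by \<open>v 0 = \<lambda>\<close> and \<open>v j = \<delta>\<^sub>j\<close> for
  \<open>1 \<le> j \<le> k\<close>. The maps below are total on \<open>nat \<Rightarrow> real\<close> and, for \<open>k \<ge> 3\<close>, preserve this space.
\<close>

definition forward_positive_cone :: "nat \<Rightarrow> (nat \<Rightarrow> real) set" where
  "forward_positive_cone k =
     {v \<in> topspace (Euclidean_space (Suc k)). (v 0)\<^sup>2 - (\<Sum>j=1..k. (v j)\<^sup>2) > 0 \<and> v 0 > 0}"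

definition reduced_vectors :: "nat \<Rightarrow> (nat \<Rightarrow> real) set" where
  "reduced_vectors k =
     {v \<in> topspace (Euclidean_space (Suc k)).
        (\<forall>i j. 1 \<le> i \<and> i \<le> j \<and> j \<le> k \<longrightarrow> v j \<le> v i) \<and> v 1 + v 2 + v 3 \<le> v 0}"

definition defect :: "(nat \<Rightarrow> real) \<Rightarrow> real" where
  "defect v = v 1 + v 2 + v 3 - v 0"

definition cremona :: "(nat \<Rightarrow> real) \<Rightarrow> (nat \<Rightarrow> real)" where
  "cremona v = (\<lambda>j. if j \<le> 3 then v j - defect v else v j)"

text \<open>The rearrangement of the entries \<open>1, \<dots>, k\<close> into weakly decreasing order.\<close>

definition sort_tail :: "nat \<Rightarrow> (nat \<Rightarrow> real) \<Rightarrow> (nat \<Rightarrow> real)" where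
  "sort_tail k v =
     (\<lambda>j. if 1 \<le> j \<and> j \<le> k then rev (sort (map v [1..<Suc k])) ! (j - 1) else v j)"

definition standard_cremona_move :: "nat \<Rightarrow> (nat \<Rightarrow> real) \<Rightarrow> (nat \<Rightarrow> real)" where
  "standard_cremona_move k v =
     (let w = sort_tail k v in if defect w \<ge> 0 then cremona w else w)"

text \<open>
  The first reduced vector among the iterates of the move. As reduced vectors are fixed by the
  move, it is the only reduced iterate. If no iterate is reduced (which does not happen on the
  forward positive cone), the value is unspecified.
\<close>

definition reduced_form :: "nat \<Rightarrow> (nat \<Rightarrow> real) \<Rightarrow> (nat \<Rightarrow> real)" where
  "reduced_form k v =
     (standard_cremona_move k ^^
        (LEAST n. (standard_cremona_move k ^^ n) v \<in> reduced_vectors k)) v"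

end

theory Submission
  imports Defs
begin

text \<open>
  The move \<open>M\<close> is continuous, being a sorting step followed by subtraction of
  \<open>max 0 defect\<close> from the first four entries, and it fixes reduced vectors. So it suffices to
  bound the number of moves locally uniformly. Permutations and the Cremona reflection are integral
  isometries of the Lorentz form that preserve the forward cone, so the leading entry of
  \<open>M\<^sup>n v\<close> is the Lorentz product of \<open>v\<close> with an integral vector \<open>x\<close> in the forward cone. By the
  Cauchy-Schwarz inequality that product is at least \<open>(v\<^sub>0 - \<parallel>v'\<parallel>) x\<^sub>0\<close>, where \<open>v'\<close> is the vector of
  the last \<open>k\<close> entries. As the leading entry never increases, \<open>x\<^sub>0 \<le> v\<^sub>0 / (v\<^sub>0 - \<parallel>v'\<parallel>)\<close>, which
  leaves finitely many \<open>x\<close>, a set that can be chosen the same for all vectors near \<open>v\<close>. As long as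
  a move does not reach a reduced vector it strictly decreases the leading entry, so the entries
  that occur are distinct, and the number of moves is at most the number of \<open>x\<close>.
\<close>

section \<open>The Lorentz form and permutations of the last entries\<close>

definition lorentz :: "nat \<Rightarrow> (nat \<Rightarrow> real) \<Rightarrow> (nat \<Rightarrow> real) \<Rightarrow> real" where
  "lorentz k u x = u 0 * x 0 - (\<Sum>j=1..k. u j * x j)"

definition antitone_tail :: "nat \<Rightarrow> (nat \<Rightarrow> real) \<Rightarrow> bool" where
  "antitone_tail k v \<longleftrightarrow> (\<forall>i j. 1 \<le> i \<and> i \<le> j \<and> j \<le> k \<longrightarrow> v j \<le> v i)"

lemma reduced_vectors_iff:
  "v \<in> reduced_vectors k \<longleftrightarrow>
     v \<in> topspace (Euclidean_space (Suc k)) \<and> antitone_tail k v \<and> defect v \<le> 0"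
  by (auto simp: reduced_vectors_def antitone_tail_def defect_def)

lemma forward_positive_cone_iff:
  "v \<in> forward_positive_cone k \<longleftrightarrow>
     v \<in> topspace (Euclidean_space (Suc k)) \<and> 0 < lorentz k v v \<and> 0 < v 0"
  by (auto simp: forward_positive_cone_def lorentz_def power2_eq_square)

lemma sum_tail_permutes:
  fixes f :: "nat \<Rightarrow> real"
  assumes "p permutes {1..k}"
  shows "(\<Sum>j=1..k. f (p j)) = (\<Sum>j=1..k. f j)"
  using sum.permute[OF assms, of f] by (simp add: o_def)

lemma permutes_tail_0: "p permutes {1..k} \<Longrightarrow> p 0 = (0::nat)"
  by (rule permutes_not_in) auto

lemma lorentz_permutes:
  assumes "p permutes {1..k}"
  shows "lorentz k (u \<circ> p) (x \<circ> p) = lorentz k u x"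
  unfolding lorentz_def o_apply sum_tail_permutes[OF assms, of "\<lambda>j. u j * x j"]
    permutes_tail_0[OF assms] ..

lemma Euclidean_space_permutes:
  assumes "p permutes {1..k}" "v \<in> topspace (Euclidean_space (Suc k))"
  shows "v \<circ> p \<in> topspace (Euclidean_space (Suc k))"
proof -
  have "p i = i" if "i \<ge> Suc k" for i
    by (rule permutes_not_in[OF assms(1)]) (use that in auto)
  then show ?thesis using assms(2) by (simp add: topspace_Euclidean_space)
qed

lemma forward_positive_cone_permutes:
  assumes "p permutes {1..k}" "v \<in> forward_positive_cone k"
  shows "v \<circ> p \<in> forward_positive_cone k"
  using assms(2) Euclidean_space_permutes[OF assms(1), of v]
    lorentz_permutes[OF assms(1), of v v] permutes_tail_0[OF assms(1)]
  by (simp add: forward_positive_cone_iff)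

section \<open>Sorting as composition with a permutation\<close>

lemma sort_tail_eqI:
  assumes "p permutes {1..k}" "antitone_tail k (v \<circ> p)"
  shows "sort_tail k v = v \<circ> p"
proof -
  have "map (v \<circ> p) [1..<Suc k] = map v (map p [1..<Suc k])" by simp
  then have "mset (map (v \<circ> p) [1..<Suc k]) = image_mset v (mset (map p [1..<Suc k]))"
    by (simp only: mset_map)
  also have "mset (map p [1..<Suc k]) = mset [1..<Suc k]"
  proof -
    have "image_mset p (mset_set {1..k}) = mset_set (p ` {1..k})"
      using assms(1) by (intro image_mset_mset_set) (auto intro: permutes_inj_on)
    also have "p ` {1..k} = {1..k}" using assms(1) by (rule permutes_image)
    finally show ?thesis
      by (simp add: mset_upt atLeastLessThanSuc_atLeastAtMost del: upt_Suc)
  qed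
  finally have ms: "mset (map (v \<circ> p) [1..<Suc k]) = mset (map v [1..<Suc k])"
    by (simp only: mset_map)
  have "sorted_wrt (\<ge>) (map (v \<circ> p) [1..<Suc k])"
    using assms(2) unfolding sorted_wrt_iff_nth_less antitone_tail_def
    by (auto simp del: upt_Suc)
  then have "sorted (rev (map (v \<circ> p) [1..<Suc k]))"
    by (simp only: sorted_wrt_rev)
  \<comment> \<open>A sorted list is determined by its multiset, so ties may make \<open>p\<close>
    ambiguous but not \<open>v \<circ> p\<close>.\<close>
  then have "sort (map v [1..<Suc k]) = rev (map (v \<circ> p) [1..<Suc k])"
    using ms by (intro properties_for_sort) (simp_all only: mset_rev)
  then have eq: "rev (sort (map v [1..<Suc k])) = map (v \<circ> p) [1..<Suc k]" by simp
  show ?thesis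
  proof
    fix j
    show "sort_tail k v j = (v \<circ> p) j"
    proof (cases "1 \<le> j \<and> j \<le> k")
      case True
      then have "map (v \<circ> p) [1..<Suc k] ! (j - 1) = (v \<circ> p) j"
        by (subst nth_map) (auto simp del: upt_Suc)
      with True eq show ?thesis by (simp add: sort_tail_def)
    next
      case False
      then have "p j = j" using assms(1) by (auto intro: permutes_not_in)
      with False show ?thesis unfolding sort_tail_def by auto
    qed
  qed
qed

lemma ex_sorting_permutation:
  "\<exists>p. p permutes {1..k} \<and> antitone_tail k (v \<circ> p)"
proof -
  \<comment> \<open>Sorting the indices instead of the values yields the permutation itself; the
    negated key gives decreasing order. List positions start at 0, hence the shift
    \<open>j - 1\<close> in \<open>p\<close>.\<close>
  define ys where "ys = sort_key (\<lambda>i. - v i) [1..<Suc k]"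
  define p where "p j = (if j \<in> {1..k} then ys ! (j - 1) else j)" for j
  have len: "length ys = k" and set: "set ys = {1..k}" and dist: "distinct ys"
    by (auto simp: ys_def)
  have "inj_on p {1..k}"
    using dist len by (auto simp: inj_on_def p_def nth_eq_iff_index_eq)
  moreover have "p ` {1..k} \<subseteq> {1..k}"
    using len set by (force simp: p_def dest: nth_mem)
  ultimately have "p permutes {1..k}"
    using endo_inj_surj[of "{1..k}" p]
    by (intro bij_imp_permutes) (simp add: bij_betw_def, auto simp: p_def)
  moreover have "antitone_tail k (v \<circ> p)"
    unfolding antitone_tail_def
  proof (intro allI impI)
    fix i j assume ij: "1 \<le> i \<and> i \<le> j \<and> j \<le> k"
    have "sorted (map (\<lambda>i. - v i) ys)" unfolding ys_def by (rule sorted_sort_key)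
    then have "map (\<lambda>i. - v i) ys ! (i - 1) \<le> map (\<lambda>i. - v i) ys ! (j - 1)"
      using ij len by (intro sorted_nth_mono) auto
    moreover have "i - 1 < length ys" "j - 1 < length ys" using ij len by auto
    ultimately show "(v \<circ> p) j \<le> (v \<circ> p) i" using ij by (simp add: p_def)
  qed
  ultimately show ?thesis by blast
qed

lemma sort_tail_permutation:
  obtains p where "p permutes {1..k}" "antitone_tail k (v \<circ> p)" "sort_tail k v = v \<circ> p"
  using ex_sorting_permutation sort_tail_eqI by blast

section \<open>Continuity of sorting and of the move\<close>

lemma continuous_on_compose_index:
  "continuous_on S (\<lambda>v::nat \<Rightarrow> real. v \<circ> p)"
  unfolding o_def
  by (intro continuous_on_coordinatewise_then_product continuous_on_subset[OF continuous_on_product_coordinates]) simp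

lemma closed_antitone_tail: "closed {v. antitone_tail k (v \<circ> p)}"
proof -
  have "{v. antitone_tail k (v \<circ> p)} =
      (\<Inter>(i, j) \<in> {(i, j). 1 \<le> i \<and> i \<le> j \<and> j \<le> k}. {v. v (p j) \<le> v (p i)})"
    by (auto simp: antitone_tail_def)
  also have "closed \<dots>"
    by (intro closed_INT ballI)
       (auto intro!: closed_Collect_le continuous_on_product_coordinates)
  finally show ?thesis .
qed

text \<open>Each permutation \<open>p\<close> has a closed region, cut out by weak inequalities, on
  which sorting is composition with \<open>p\<close>. These finitely many regions cover the space,
  so the continuous pieces glue.\<close>

lemma continuous_on_sort_tail: "continuous_on UNIV (sort_tail k)"
proof -
  have "continuous_on (\<Union>p\<in>{p. p permutes {1..k}}. {v. antitone_tail k (v \<circ> p)}) (sort_tail k)"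
  proof (rule continuous_on_closed_Union)
    show "finite {p. p permutes {1..k}}" by (simp add: finite_permutations)
    show "closed {v. antitone_tail k (v \<circ> p)}" for p by (rule closed_antitone_tail)
    show "continuous_on {v. antitone_tail k (v \<circ> p)} (sort_tail k)"
      if "p \<in> {p. p permutes {1..k}}" for p
      using that continuous_on_compose_index
      by (subst continuous_on_cong[OF refl, of _ _ "\<lambda>v. v \<circ> p"]) (auto simp: sort_tail_eqI)
  qed
  moreover have "(\<Union>p\<in>{p. p permutes {1..k}}. {v. antitone_tail k (v \<circ> p)}) = UNIV"
    using ex_sorting_permutation by blast
  ultimately show ?thesis by simp
qed

text \<open>The two branches of the move agree where the defect is 0; writing them as one formula
  with \<open>max\<close> makes continuity visible.\<close>

lemma standard_cremona_move_eq:
  "standard_cremona_move k v =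
     (\<lambda>j. if j \<le> 3 then sort_tail k v j - max 0 (defect (sort_tail k v)) else sort_tail k v j)"
  by (auto simp: standard_cremona_move_def cremona_def Let_def)

lemma continuous_on_standard_cremona_move: "continuous_on UNIV (standard_cremona_move k)"
proof (rule continuous_on_coordinatewise_then_product)
  have coord: "continuous_on UNIV (\<lambda>v. sort_tail k v j)" for j
    by (rule continuous_on_product_then_coordinatewise[OF continuous_on_sort_tail])
  show "continuous_on UNIV (\<lambda>v. standard_cremona_move k v j)" for j
    unfolding standard_cremona_move_eq defect_def
    by (cases "j \<le> 3") (auto intro!: continuous_intros coord)
qed

lemma continuous_on_standard_cremona_move_funpow:
  "continuous_on UNIV (standard_cremona_move k ^^ n)"
proof (induction n)
  case 0
  then show ?case by (simp add: id_def)
next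
  case (Suc n)
  then show ?case
    by (simp only: funpow.simps)
       (rule continuous_on_compose, auto intro: continuous_on_subset[OF continuous_on_standard_cremona_move])
qed

section \<open>The Cremona map as a Lorentz reflection\<close>

lemma lorentz_cremona:
  assumes "k \<ge> 3"
  shows "lorentz k (cremona v) x = lorentz k v x + defect v * defect x"
proof -
  have "(\<Sum>j=1..k. cremona v j * x j) =
      (\<Sum>j=1..k. v j * x j - (if j \<in> {1..3} then defect v * x j else 0))"
    by (intro sum.cong) (auto simp: cremona_def algebra_simps)
  also have "\<dots> = (\<Sum>j=1..k. v j * x j) - (\<Sum>j\<in>{1..k} \<inter> {1..3}. defect v * x j)"
    by (simp only: sum_subtractf sum.inter_restrict[OF finite_atLeastAtMost])
  also have "{1..k} \<inter> {1..3} = {1, 2, 3}" using assms by auto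
  finally show ?thesis
    by (simp add: lorentz_def cremona_def defect_def algebra_simps)
qed

lemma lorentz_commute: "lorentz k u x = lorentz k x u"
  by (simp add: lorentz_def mult.commute)

text \<open>For \<open>r = (1; 1, 1, 1, 0, ..., 0)\<close> one has
  \<open>defect v = - lorentz k v r\<close> and \<open>lorentz k r r = -2\<close>, so
  \<open>cremona\<close> is the reflection in \<open>r\<close> and hence self-adjoint.\<close>

lemma lorentz_cremona_adjoint:
  "k \<ge> 3 \<Longrightarrow> lorentz k (cremona v) x = lorentz k v (cremona x)"
  by (simp add: lorentz_cremona lorentz_commute[of k v "cremona x"] lorentz_commute[of k v x])

lemma defect_cremona: "defect (cremona v) = - defect v"
  by (simp add: cremona_def defect_def)

lemma Euclidean_space_cremona:
  "k \<ge> 3 \<Longrightarrow> v \<in> topspace (Euclidean_space (Suc k)) \<Longrightarrow>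
    cremona v \<in> topspace (Euclidean_space (Suc k))"
  by (auto simp: topspace_Euclidean_space cremona_def)

text \<open>A reflection preserves the form, so only the sign of the new leading entry
  \<open>2 * v 0 - (v 1 + v 2 + v 3)\<close> is at issue. By Cauchy-Schwarz the square of the
  bracket is at most 3 times the sum of the three squares, hence below
  \<open>4 * (v 0)\<^sup>2\<close>.\<close>

lemma forward_positive_cone_cremona:
  assumes "k \<ge> 3" "v \<in> forward_positive_cone k"
  shows "cremona v \<in> forward_positive_cone k"
proof -
  have "(\<Sum>j\<in>{1,2,3}. (v j)\<^sup>2) \<le> (\<Sum>j=1..k. (v j)\<^sup>2)"
    using assms(1) by (intro sum_mono2) auto
  then have "(v 1)\<^sup>2 + (v 2)\<^sup>2 + (v 3)\<^sup>2 < (v 0)\<^sup>2"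
    using assms(2) by (simp add: forward_positive_cone_def)
  moreover have "(v 1 + v 2 + v 3)\<^sup>2 \<le> 3 * ((v 1)\<^sup>2 + (v 2)\<^sup>2 + (v 3)\<^sup>2)"
  proof -
    have "0 \<le> (v 1 - v 2)\<^sup>2 + (v 1 - v 3)\<^sup>2 + (v 2 - v 3)\<^sup>2" by simp
    then show ?thesis by (simp add: power2_eq_square algebra_simps)
  qed
  ultimately have "(v 1 + v 2 + v 3)\<^sup>2 < 4 * (v 0)\<^sup>2"
    using zero_le_power2[of "v 0"] by (simp only: distrib_left)
  then have "(v 1 + v 2 + v 3)\<^sup>2 < (2 * v 0)\<^sup>2"
    by (simp add: power_mult_distrib)
  then have "v 1 + v 2 + v 3 < 2 * v 0"
    by (rule power2_less_imp_less) (use assms(2) in \<open>simp add: forward_positive_cone_def\<close>)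
  then have "0 < cremona v 0" by (simp add: cremona_def defect_def)
  moreover have "lorentz k (cremona v) (cremona v) = lorentz k v v"
    using assms(1)
    by (simp add: lorentz_cremona lorentz_commute[of k v "cremona v"] defect_cremona)
  ultimately show ?thesis
    using assms by (auto simp: forward_positive_cone_iff Euclidean_space_cremona)
qed

lemma forward_positive_cone_sort_tail:
  assumes "v \<in> forward_positive_cone k"
  shows "sort_tail k v \<in> forward_positive_cone k"
proof -
  obtain p where "p permutes {1..k}" "antitone_tail k (v \<circ> p)" and eq: "sort_tail k v = v \<circ> p"
    by (rule sort_tail_permutation)
  then show ?thesis unfolding eq using assms by (intro forward_positive_cone_permutes)
qed

lemma forward_positive_cone_move:
  assumes "k \<ge> 3" "v \<in> forward_positive_cone k"
  shows "standard_cremona_move k v \<in> forward_positive_cone k"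
proof -
  have sorted: "sort_tail k v \<in> forward_positive_cone k"
    by (rule forward_positive_cone_sort_tail[OF assms(2)])
  have "standard_cremona_move k v = cremona (sort_tail k v) \<or>
      standard_cremona_move k v = sort_tail k v"
    by (simp add: standard_cremona_move_def Let_def)
  with sorted forward_positive_cone_cremona[OF assms(1) sorted] show ?thesis by metis
qed

lemma forward_positive_cone_move_funpow:
  assumes "k \<ge> 3" "v \<in> forward_positive_cone k"
  shows "(standard_cremona_move k ^^ n) v \<in> forward_positive_cone k"
proof (induction n)
  case (Suc n)
  show ?case using forward_positive_cone_move[OF assms(1) Suc] by simp
qed (simp add: assms(2))

section \<open>Leading entries of iterates as products with integral vectors\<close>

definition integral_cone :: "nat \<Rightarrow> (nat \<Rightarrow> real) set" where
  "integral_cone k = {x \<in> forward_positive_cone k. \<forall>i. x i \<in> \<int>}"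

text \<open>The move acts on \<open>v\<close> by a permutation, possibly followed by the reflection.
  The adjoint of that map, applied to \<open>x\<close>, gives \<open>y\<close>; it depends on
  \<open>v\<close> but preserves integrality and the cone.\<close>

lemma lorentz_move:
  assumes "k \<ge> 3" "x \<in> integral_cone k"
  shows "\<exists>y \<in> integral_cone k. lorentz k (standard_cremona_move k v) x = lorentz k v y"
proof -
  define w where "w = sort_tail k v"
  obtain p where p: "p permutes {1..k}" "antitone_tail k (v \<circ> p)" "w = v \<circ> p"
    unfolding w_def by (rule sort_tail_permutation)
  \<comment> \<open>The branch is the one the move takes on \<open>v\<close>, so it is decided by
    \<open>defect w\<close> and not by \<open>x\<close>.\<close>
  define x' where "x' = (if defect w \<ge> 0 then cremona x else x)"
  have "cremona x \<in> integral_cone k"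
    using assms by (auto simp: integral_cone_def forward_positive_cone_cremona)
      (auto simp: cremona_def defect_def)
  then have x': "x' \<in> integral_cone k"
    using assms by (simp add: x'_def)
  have "lorentz k (standard_cremona_move k v) x = lorentz k w x'"
    using assms by (simp add: standard_cremona_move_def Let_def x'_def lorentz_cremona_adjoint
        flip: w_def)
  also have "\<dots> = lorentz k (v \<circ> p) ((x' \<circ> inv p) \<circ> p)"
    using p by (simp add: comp_assoc permutes_inv_o)
  also have "\<dots> = lorentz k v (x' \<circ> inv p)"
    by (rule lorentz_permutes[OF p(1)])
  finally have "lorentz k (standard_cremona_move k v) x = lorentz k v (x' \<circ> inv p)" .
  moreover have "x' \<circ> inv p \<in> integral_cone k"
    using x' forward_positive_cone_permutes[OF permutes_inv[OF p(1)]]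
    by (auto simp: integral_cone_def)
  ultimately show ?thesis by blast
qed

lemma move_funpow_0_eq_lorentz:
  assumes "k \<ge> 3"
  shows "\<exists>x \<in> integral_cone k. (standard_cremona_move k ^^ n) v 0 = lorentz k v x"
proof (induction n arbitrary: v)
  case 0
  \<comment> \<open>Pairing with \<open>(1; 0, ..., 0)\<close> reads off the leading entry.\<close>
  define e :: "nat \<Rightarrow> real" where "e i = (if i = 0 then 1 else 0)" for i
  have "e \<in> integral_cone k"
    by (auto simp: integral_cone_def forward_positive_cone_def topspace_Euclidean_space e_def)
  moreover have "lorentz k v e = v 0" by (simp add: lorentz_def e_def)
  ultimately show ?case by (auto intro!: bexI[of _ e])
next
  case (Suc n)
  \<comment> \<open>The first of the \<open>Suc n\<close> moves is split off, so the induction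
    hypothesis is used at the moved vector.\<close>
  obtain x where x: "x \<in> integral_cone k"
    "(standard_cremona_move k ^^ n) (standard_cremona_move k v) 0
      = lorentz k (standard_cremona_move k v) x"
    using Suc.IH[of "standard_cremona_move k v"] by blast
  then show ?case
    using lorentz_move[OF assms x(1), of v] by (simp add: funpow_swap1)
qed

section \<open>Finiteness of the relevant integral vectors\<close>

lemma L2_set_tail_less:
  assumes "v \<in> forward_positive_cone k"
  shows "L2_set v {1..k} < v 0"
proof -
  have "sqrt (\<Sum>j=1..k. (v j)\<^sup>2) < sqrt ((v 0)\<^sup>2)"
    using assms by (intro real_sqrt_less_mono) (simp add: forward_positive_cone_def)
  then show ?thesis using assms by (simp add: L2_set_def forward_positive_cone_def)
qed

text \<open>Cauchy-Schwarz on the last \<open>k\<close> entries, where the norm of those of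
  \<open>x\<close> is below \<open>x 0\<close>. For \<open>u\<close> in the cone the factor of
  \<open>x 0\<close> is positive, so a bound on the product bounds \<open>x 0\<close>.\<close>

lemma lorentz_ge:
  assumes "x \<in> forward_positive_cone k"
  shows "(u 0 - L2_set u {1..k}) * x 0 \<le> lorentz k u x"
proof -
  have "(\<Sum>j=1..k. u j * x j) \<le> (\<Sum>j=1..k. \<bar>u j\<bar> * \<bar>x j\<bar>)"
    by (intro sum_mono) (metis abs_ge_self abs_mult)
  also have "\<dots> \<le> L2_set u {1..k} * L2_set x {1..k}" by (rule L2_set_mult_ineq)
  also have "\<dots> \<le> L2_set u {1..k} * x 0"
    using L2_set_tail_less[OF assms] by (intro mult_left_mono) auto
  finally show ?thesis by (simp add: lorentz_def algebra_simps)
qed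

text \<open>In the cone the leading entry dominates every other in absolute value, so all
  \<open>k + 1\<close> entries are integers in a bounded interval.\<close>

lemma finite_bounded_integral_cone: "finite {x \<in> integral_cone k. x 0 \<le> B}"
proof (rule finite_subset)
  have "\<bar>x i\<bar> \<le> B" if x: "x \<in> integral_cone k" "x 0 \<le> B" and i: "i < Suc k" for x i
  proof (cases "i = 0")
    case True
    then show ?thesis using x by (simp add: integral_cone_def forward_positive_cone_def)
  next
    case False
    then have "(x i)\<^sup>2 \<le> (\<Sum>j=1..k. (x j)\<^sup>2)"
      using i by (intro member_le_sum) auto
    then have "(x i)\<^sup>2 \<le> (x 0)\<^sup>2"
      using x by (simp add: integral_cone_def forward_positive_cone_def)
    then show ?thesis
      using x by (simp add: abs_le_square_iff[symmetric] integral_cone_def forward_positive_cone_def)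
  qed
  then show "{x \<in> integral_cone k. x 0 \<le> B} \<subseteq>
    {x. \<forall>i. (i \<in> {..<Suc k} \<longrightarrow> x i \<in> {r \<in> \<int>. \<bar>r\<bar> \<le> B}) \<and> (i \<notin> {..<Suc k} \<longrightarrow> x i = 0)}"
    by (auto simp: integral_cone_def forward_positive_cone_def topspace_Euclidean_space)
  show "finite {x. \<forall>i. (i \<in> {..<Suc k} \<longrightarrow> x i \<in> {r \<in> \<int>. \<bar>r\<bar> \<le> B}) \<and>
      (i \<notin> {..<Suc k} \<longrightarrow> x i = (0::real))}"
    by (intro finite_set_of_finite_funs finite_abs_int_segment) simp
qed

section \<open>Descent of the leading entry and stabilization\<close>

lemma sort_tail_0: "sort_tail k v 0 = v 0"
  by (simp add: sort_tail_def)

lemma move_0_le: "standard_cremona_move k v 0 \<le> v 0"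
  by (simp add: standard_cremona_move_eq sort_tail_0)

text \<open>The hypothesis concerns the image, since a non-reduced \<open>v\<close> may become
  reduced by sorting alone, with the leading entry unchanged. If the sorted vector had defect at
  most 0, the move would only sort and its result would be reduced.\<close>

lemma move_0_less:
  assumes "v \<in> topspace (Euclidean_space (Suc k))"
    "standard_cremona_move k v \<notin> reduced_vectors k"
  shows "standard_cremona_move k v 0 < v 0"
proof -
  obtain p where p: "p permutes {1..k}" "antitone_tail k (v \<circ> p)" "sort_tail k v = v \<circ> p"
    by (rule sort_tail_permutation)
  have "defect (sort_tail k v) > 0"
  proof (rule ccontr)
    assume neg: "\<not> 0 < defect (sort_tail k v)"
    then have "standard_cremona_move k v = sort_tail k v"
      by (auto simp: standard_cremona_move_eq max_def)
    with neg p assms show False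
      by (simp add: reduced_vectors_iff Euclidean_space_permutes)
  qed
  then show ?thesis by (simp add: standard_cremona_move_eq sort_tail_0)
qed

lemma move_reduced:
  assumes "v \<in> reduced_vectors k"
  shows "standard_cremona_move k v = v"
proof -
  have "sort_tail k v = v \<circ> id"
    using assms by (intro sort_tail_eqI permutes_id) (simp add: reduced_vectors_iff)
  then show ?thesis using assms
    by (auto simp: standard_cremona_move_eq reduced_vectors_iff max_def)
qed

lemma move_funpow_reduced:
  "v \<in> reduced_vectors k \<Longrightarrow> (standard_cremona_move k ^^ n) v = v"
  by (induction n) (simp_all add: move_reduced)

lemma move_funpow_stable:
  assumes "(standard_cremona_move k ^^ m) v \<in> reduced_vectors k" "m \<le> n"
  shows "(standard_cremona_move k ^^ n) v = (standard_cremona_move k ^^ m) v"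
proof -
  have "(standard_cremona_move k ^^ (n - m + m)) v = (standard_cremona_move k ^^ m) v"
    using assms(1) by (simp only: funpow_add o_apply move_funpow_reduced)
  then show ?thesis using assms(2) by simp
qed

text \<open>This replaces the least exponent, which varies with \<open>v\<close>, by any sufficient
  one, so that a single exponent can serve a whole neighborhood.\<close>

lemma reduced_form_eq:
  assumes "(standard_cremona_move k ^^ n) v \<in> reduced_vectors k"
  shows "reduced_form k v = (standard_cremona_move k ^^ n) v"
  using move_funpow_stable[OF LeastI[of "\<lambda>n. (standard_cremona_move k ^^ n) v \<in> reduced_vectors k", OF assms],
      OF Least_le, of n] assms
  by (simp add: reduced_form_def)

section \<open>A locally uniform bound on the number of moves\<close>

lemma move_funpow_card_reduced:
  assumes k: "k \<ge> 3" and v: "v \<in> forward_positive_cone k"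
    and B: "v 0 \<le> B * (v 0 - L2_set v {1..k})"
  shows "(standard_cremona_move k ^^ card {x \<in> integral_cone k. x 0 \<le> B}) v \<in> reduced_vectors k"
    (is "(?M ^^ card ?X) v \<in> _")
proof (rule ccontr)
  assume nred: "(?M ^^ card ?X) v \<notin> reduced_vectors k"
  have dec: "(?M ^^ Suc n) v 0 < (?M ^^ n) v 0" if "n < card ?X" for n
  proof -
    have "(?M ^^ Suc n) v \<notin> reduced_vectors k"
      \<comment> \<open>A reduced iterate would persist up to exponent \<open>card ?X\<close>,
        against \<open>nred\<close>.\<close>
      using move_funpow_stable[of "Suc n" k v "card ?X"] nred that by auto
    then show ?thesis
      using move_0_less[of "(?M ^^ n) v" k] forward_positive_cone_move_funpow[OF k v, of n]
      by (simp add: forward_positive_cone_def)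
  qed
  have less: "(?M ^^ n) v 0 < (?M ^^ m) v 0" if "m < n" "n \<le> card ?X" for m n
    using that
  proof (induction n)
    case (Suc n)
    then show ?case using dec[of n] by (cases "m = n") auto
  qed simp
  have inj: "inj_on (\<lambda>n. (?M ^^ n) v 0) {..card ?X}"
  proof (rule inj_onI)
    fix m n
    assume "m \<in> {..card ?X}" "n \<in> {..card ?X}" "(?M ^^ m) v 0 = (?M ^^ n) v 0"
    then show "m = n" using less[of m n] less[of n m] by (cases m n rule: linorder_cases) auto
  qed
  have le: "(?M ^^ n) v 0 \<le> v 0" for n
    by (induction n) (auto intro: order_trans[OF move_0_le])
  have "(\<lambda>n. (?M ^^ n) v 0) ` {..card ?X} \<subseteq> lorentz k v ` ?X"
  proof (rule image_subsetI)
    fix n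
    obtain x where x: "x \<in> integral_cone k" "(?M ^^ n) v 0 = lorentz k v x"
      using move_funpow_0_eq_lorentz[OF k] by blast
    define d where "d = v 0 - L2_set v {1..k}"
    have "d > 0" using L2_set_tail_less[OF v] by (simp add: d_def)
    moreover have "d * x 0 \<le> d * B"
      using lorentz_ge[of x k v] x le[of n] B
      by (simp add: integral_cone_def d_def mult.commute)
    ultimately have "x 0 \<le> B" by simp
    with x show "(?M ^^ n) v 0 \<in> lorentz k v ` ?X" by auto
  qed
  \<comment> \<open>Pigeonhole: exponents 0 to \<open>card ?X\<close> give
    \<open>card ?X + 1\<close> distinct leading entries, but only \<open>card ?X\<close> vectors are
    available.\<close>
  then have "card ((\<lambda>n. (?M ^^ n) v 0) ` {..card ?X}) \<le> card ?X"
    using finite_bounded_integral_cone by (meson card_image_le card_mono finite_imageI le_trans)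
  then show False by (simp add: card_image[OF inj])
qed

text \<open>The exponent in the previous bound depends only on \<open>k\<close> and
  \<open>B\<close>. The strict inequality \<open>u 0 < B * d u\<close> is an open condition on
  \<open>u\<close>, so a \<open>B\<close> chosen for \<open>v\<close> works near
  \<open>v\<close>.\<close>

lemma locally_uniform_reduction:
  assumes k: "k \<ge> 3" and v: "v \<in> forward_positive_cone k"
  obtains U n where "open U" "v \<in> U"
    "\<And>u. u \<in> U \<inter> forward_positive_cone k \<Longrightarrow>
       (standard_cremona_move k ^^ n) u \<in> reduced_vectors k"
proof -
  define d where "d u = u 0 - L2_set u {1..k}" for u :: "nat \<Rightarrow> real"
  have "d v > 0" using L2_set_tail_less[OF v] by (simp add: d_def)
  then obtain B where B: "v 0 < B * d v"
    using reals_Archimedean3 by blast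
  have "continuous_on UNIV d"
    unfolding d_def L2_set_def
    by (intro continuous_intros continuous_on_product_coordinates)
  then have "open {u. u 0 < B * d u}"
    by (intro open_Collect_less continuous_intros continuous_on_product_coordinates)
  moreover have "(standard_cremona_move k ^^ card {x \<in> integral_cone k. x 0 \<le> B}) u
      \<in> reduced_vectors k" if "u \<in> {u. u 0 < B * d u} \<inter> forward_positive_cone k" for u
    using that by (intro move_funpow_card_reduced[OF k]) (auto simp: d_def)
  ultimately show ?thesis using B by (intro that) auto
qed

section \<open>Continuity of the reduction\<close>

lemma continuous_on_reduced_form:
  assumes k: "k \<ge> 3"
  shows "continuous_on (forward_positive_cone k) (reduced_form k)"
  unfolding continuous_on_eq_continuous_within
proof
  fix v assume v: "v \<in> forward_positive_cone k"
  obtain U n where U: "open U" "v \<in> U"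
    "\<And>u. u \<in> U \<inter> forward_positive_cone k \<Longrightarrow>
       (standard_cremona_move k ^^ n) u \<in> reduced_vectors k"
    by (rule locally_uniform_reduction[OF k v]) blast
  \<comment> \<open>On this set the reduced form is one fixed iterate of the move, hence
    continuous.\<close>
  have "continuous_on (U \<inter> forward_positive_cone k) (reduced_form k)"
    using U(3) continuous_on_subset[OF continuous_on_standard_cremona_move_funpow[of n k]]
    by (subst continuous_on_cong[OF refl, of _ _ "standard_cremona_move k ^^ n"])
       (auto simp: reduced_form_eq)
  then have "continuous (at v within (U \<inter> forward_positive_cone k)) (reduced_form k)"
    using U v by (auto simp: continuous_on_eq_continuous_within)
  moreover have "at v within (U \<inter> forward_positive_cone k) = at v within forward_positive_cone k"
    using U by (intro at_within_nhd[of v U]) auto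
  ultimately show "continuous (at v within forward_positive_cone k) (reduced_form k)" by simp
qed

theorem lemma2p18:
  fixes k :: nat
  assumes "k \<ge> 3"
  shows "continuous_map
           (subtopology (Euclidean_space (Suc k)) (forward_positive_cone k))
           (subtopology (Euclidean_space (Suc k)) (forward_positive_cone k \<inter> reduced_vectors k))
           (reduced_form k)"
proof -
  have maps: "reduced_form k v \<in> forward_positive_cone k \<inter> reduced_vectors k"
    if v: "v \<in> forward_positive_cone k" for v
  proof -
    obtain U n where "v \<in> U" "\<And>u. u \<in> U \<inter> forward_positive_cone k \<Longrightarrow>
        (standard_cremona_move k ^^ n) u \<in> reduced_vectors k"
      by (rule locally_uniform_reduction[OF assms v]) blast
    then have "(standard_cremona_move k ^^ n) v \<in> reduced_vectors k" using v by blast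
    then show ?thesis
      using reduced_form_eq forward_positive_cone_move_funpow[OF assms v, of n] by simp
  qed
  \<comment> \<open>\<open>Euclidean_space\<close> is itself a subspace of the product topology,
    which is the type class topology on functions; this transfers the \<open>continuous_on\<close>
    result to \<open>continuous_map\<close>.\<close>
  have sub: "subtopology (Euclidean_space (Suc k)) S = subtopology euclidean S"
    if "S \<subseteq> topspace (Euclidean_space (Suc k))" for S
    using that
    by (auto simp: Euclidean_space_def topspace_Euclidean_space subtopology_subtopology
        euclidean_product_topology intro!: arg_cong[of _ _ "subtopology _"])
  have cone: "forward_positive_cone k \<subseteq> topspace (Euclidean_space (Suc k))"
    by (auto simp: forward_positive_cone_def)
  then have "forward_positive_cone k \<inter> reduced_vectors k \<subseteq> topspace (Euclidean_space (Suc k))"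
    by blast
  with cone show ?thesis
    using maps continuous_on_reduced_form[OF assms]
    by (simp add: sub continuous_map_in_subtopology Pi_iff)
qed

end
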